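(* Let $k\ge 3$ be a fixed integer and let $p$ be the largest prime power (with $1$ counted as a prime power) satisfying $p^2+p+1\le k$. Then, as $n\to\infty$, $$n\left(\frac12-\frac{1}{2\sqrt k}\right)(1+o_n(1))\ \ge\ f(n,k)\ \ge\ n\left(\frac12-\frac{p+1}{2(p^2+p+1)}\right)(1+o_n(1)).$$
   Context: $K_n$ denotes the complete graph on $n$ vertices. For a $k$-edge coloring $c:E(K_n)\to\{1,\ldots,k\}$ (an arbitrary map, not necessarily proper), let $f(K_n,c)$ be the minimum, over the colors $i\in\{1,\ldots,k\}$, of the number of connected components of the subgraph induced by the edges of color $i$; this subgraph consists of the edges of color $i$ and their endpoints, so isolated vertices are not counted as components (an unused color has $0$ components). $f(n,k)$ is the maximum of $f(K_n,c)$ over all $k$-edge colorings $c$ of $K_n$ (with $k\le\binom n2$). Here $o_n(1)$ denotes a quantity tending to $0$ as $n\to\infty$ with $k$ fixed (possibly a different quantity on each side). *)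

theory Defs
  imports
    Complex_Main
    "HOL-Library.FuncSet"
    "HOL-Number_Theory.Prime_Powers"
    "Graph_Theory.Graph_Theory"
begin

text \<open>
  Simple undirected graphs are represented, as in Graph_Theory, by symmetric loop-free digraphs
  whose arcs are ordered pairs.
\<close>

definition complete_graph :: "nat \<Rightarrow> nat pair_pre_digraph" where
  "complete_graph n = \<lparr> pverts = {1..n}, parcs = {(u, v). u \<in> {1..n} \<and> v \<in> {1..n} \<and> u \<noteq> v} \<rparr>"

lemma complete_graph_is_complete: "K\<^bsub>n\<^esub> (with_proj (complete_graph n))"
  by (auto simp: complete_digraph_pair_def complete_graph_def)

definition edge_set :: "'a pair_pre_digraph \<Rightarrow> 'a set set" where
  "edge_set G = {{u, v} | u v. (u, v) \<in> parcs G}"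

text \<open>
  Edges are coloured as unordered pairs. The vertices of a colour class are only the endpoints of
  its edges, so a colour class has no isolated vertices, and it is empty if the colour is unused.
\<close>

definition colour_class :: "'a pair_pre_digraph \<Rightarrow> ('a set \<Rightarrow> nat) \<Rightarrow> nat \<Rightarrow> 'a pair_pre_digraph" where
  "colour_class G c i =
     \<lparr> pverts = \<Union> {e \<in> edge_set G. c e = i},
       parcs = {(u, v) \<in> parcs G. c {u, v} = i} \<rparr>"

text \<open>For symmetric digraphs, strongly connected components are the connected components.\<close>

definition num_components :: "'a pair_pre_digraph \<Rightarrow> nat" where
  "num_components G = card (pre_digraph.sccs (with_proj G))"

definition min_components :: "'a pair_pre_digraph \<Rightarrow> nat \<Rightarrow> ('a set \<Rightarrow> nat) \<Rightarrow> nat" where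
  "min_components G k c = Min ((\<lambda>i. num_components (colour_class G c i)) ` {1..k})"

definition edge_colourings :: "'a pair_pre_digraph \<Rightarrow> nat \<Rightarrow> ('a set \<Rightarrow> nat) set" where
  "edge_colourings G k = edge_set G \<rightarrow>\<^sub>E {1..k}"

text \<open>
  The side condition \<open>k \<le> n choose 2\<close> is not built in: for fixed \<open>k\<close> it holds for all
  sufficiently large \<open>n\<close>, and otherwise some colour is unused and the value is 0.
\<close>

definition max_min_components :: "nat \<Rightarrow> nat \<Rightarrow> nat" where
  "max_min_components n k =
     Max (min_components (complete_graph n) k ` edge_colourings (complete_graph n) k)"

lemma finite_edge_set_complete_graph: "finite (edge_set (complete_graph n))"
  by (rule finite_subset[of _ "Pow {1..n}"]) (auto simp: edge_set_def complete_graph_def)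

lemma finite_edge_colourings: "finite (edge_colourings (complete_graph n) k)"
  by (simp add: edge_colourings_def finite_PiE finite_edge_set_complete_graph)

lemma edge_colourings_nonempty: "k \<ge> 1 \<Longrightarrow> edge_colourings G k \<noteq> {}"
  by (auto simp: edge_colourings_def PiE_eq_empty_iff)

lemma parcs_colour_class_subset:
  "parcs (colour_class G c i) \<subseteq> pverts (colour_class G c i) \<times> pverts (colour_class G c i)"
proof (rule subrelI)
  fix u v assume "(u, v) \<in> parcs (colour_class G c i)"
  then have "{u, v} \<in> {e \<in> edge_set G. c e = i}"
    by (auto simp: colour_class_def edge_set_def)
  then have "{u, v} \<subseteq> pverts (colour_class G c i)"
    unfolding colour_class_def pair_pre_digraph.simps by (rule Union_upper)
  then show "(u, v) \<in> pverts (colour_class G c i) \<times> pverts (colour_class G c i)"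
    by simp
qed

lemma pverts_colour_class_subset: "pverts (colour_class (complete_graph n) c i) \<subseteq> {1..n}"
  by (auto simp: colour_class_def edge_set_def complete_graph_def)

lemma pair_graph_colour_class: "pair_graph (colour_class (complete_graph n) c i)"
proof -
  let ?H = "colour_class (complete_graph n) c i"
  have fin: "finite (pverts ?H)"
    using pverts_colour_class_subset by (rule finite_subset) simp
  have fin': "finite (parcs ?H)"
    using parcs_colour_class_subset by (rule finite_subset) (simp add: fin)
  have irrefl: "u \<noteq> v" if "(u, v) \<in> parcs ?H" for u v
    using that by (simp add: colour_class_def complete_graph_def)
  have "sym (parcs ?H)"
    by (rule symI) (simp add: colour_class_def complete_graph_def insert_commute)
  then have "symmetric (with_proj ?H)"
    by (simp add: symmetric_def)
  then show ?thesis
    using fin fin' irrefl parcs_colour_class_subset[of "complete_graph n" c i]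
    by unfold_locales auto
qed

text \<open>Unlike \<^const>\<open>primepow\<close>, this counts 1 as a prime power.\<close>

definition prime_power_or_one :: "nat \<Rightarrow> bool" where
  "prime_power_or_one q \<longleftrightarrow> q = 1 \<or> primepow q"

end

theory Submission
  imports Defs "Jordan_Normal_Form.Char_Poly"
begin

text \<open>
  The upper bound is an edge count. If a colour has at least \<open>f\<close> components, each of them with at
  least two vertices, then at most about \<open>n - 2 f\<close> vertices remain to enlarge some of them. The
  number of edges is essentially largest when a single component receives them all, and so it is at
  most \<open>(n - 2 f)\<^sup>2/2 + O(n)\<close> (\<open>card_arcs_le_of_num_components\<close>). The \<open>k\<close> classes together contain
  all \<open>n (n - 1)/2\<close> edges, which forces \<open>n - 2 f \<ge> (1 - o(1)) n / sqrt k\<close>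
  (\<open>max_min_components_edge_count\<close>).

  The lower bound comes from a projective plane of order \<open>p\<close> with \<open>Q = p\<^sup>2 + p + 1\<close> points and
  lines. Divide the vertices into \<open>Q\<close> groups of almost equal size, one for each point, and colour an
  edge by a line through the points of its two end groups. The class of a line then lives on the
  \<open>p + 1\<close> groups on that line. The remaining \<open>Q - p - 1\<close> groups are free for an almost perfect
  matching recoloured with the same colour; its edges are components of their own, about
  \<open>n/2 - n (p + 1)/(2 Q)\<close> in number. Taking the matchings of all \<open>k\<close> colours pairwise disjoint,
  which is easy inside the groups, makes the recolourings compatible, and it also serves the colours
  that exceed the number of lines (\<open>components_of_line_colouring\<close>).

  The algebraic input is a plane of order \<open>p\<close>. For \<open>p = 1\<close> it is a triangle, and for \<open>p > 1\<close> it is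
  the plane over a field with \<open>p\<close> elements, which is obtained as a residue field of a ring of
  cyclotomic integers (\<open>finite_field_of_prime_power_order\<close>).
\<close>

section \<open>Finite fields as residue fields of cyclotomic integers\<close>

text \<open>
  If \<open>p g(\<zeta>) = 1\<close>, then \<open>1/p\<close> is an algebraic integer, which is absurd. To see this, let \<open>g(\<zeta>)\<close> act
  by multiplication on the vector \<open>(1, \<zeta>, \<dots>, \<zeta>\<^bsup>N-1\<^esup>)\<close>: reducing exponents modulo \<open>N\<close> turns this
  action into a circulant integer matrix of which \<open>g(\<zeta>)\<close> is an eigenvalue, and the characteristic
  polynomial of that matrix is monic with integer coefficients.
\<close>

lemma prime_not_unit_in_cyclotomic_ring:
  fixes \<zeta> :: complex and p N :: nat and g :: "int poly"
  assumes root: "\<zeta> ^ N = 1" and N: "N > 0" and p: "p > 1"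
  shows "of_nat p * poly (map_poly of_int g) \<zeta> \<noteq> 1"
proof
  assume unit: "of_nat p * poly (map_poly of_int g) \<zeta> = 1"
  define A :: "int mat" where
    "A = mat N N (\<lambda>(i, l). \<Sum>j\<in>{j. j \<le> degree g \<and> (i + j) mod N = l}. coeff g j)"
  define B :: "complex mat" where "B = map_mat of_int A"
  define v where "v = vec N (\<lambda>i. \<zeta> ^ i)"
  let ?x = "poly (map_poly of_int g) \<zeta>"
  have A: "A \<in> carrier_mat N N" and B: "B \<in> carrier_mat N N"
    by (auto simp: A_def B_def)
  have power_mod: "\<zeta> ^ (j mod N) = \<zeta> ^ j" for j
    by (metis root mod_mult_div_eq mult.right_neutral power_add power_mult power_one)
  have x: "?x = (\<Sum>j\<le>degree g. of_int (coeff g j) * \<zeta> ^ j)"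
    by (simp add: poly_altdef degree_map_poly coeff_map_poly)
  have row: "(\<Sum>l<N. of_int (\<Sum>j\<in>{j. j \<le> degree g \<and> (i + j) mod N = l}. coeff g j) * \<zeta> ^ l)
      = ?x * \<zeta> ^ i" (is "?lhs = _") for i
  proof -
    have "?lhs = (\<Sum>l<N. \<Sum>j\<in>{j \<in> {..degree g}. (i + j) mod N = l}.
        of_int (coeff g j) * \<zeta> ^ (i + j))"
    proof (rule sum.cong[OF refl])
      fix l
      show "of_int (\<Sum>j\<in>{j. j \<le> degree g \<and> (i + j) mod N = l}. coeff g j) * \<zeta> ^ l
        = (\<Sum>j\<in>{j \<in> {..degree g}. (i + j) mod N = l}. of_int (coeff g j) * \<zeta> ^ (i + j))"
        unfolding of_int_sum sum_distrib_right
        by (rule sum.cong) (auto simp: power_mod)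
    qed
    also have "\<dots> = (\<Sum>j\<le>degree g. of_int (coeff g j) * \<zeta> ^ (i + j))"
      by (rule sum.group) (use N in auto)
    also have "\<dots> = ?x * \<zeta> ^ i"
      by (simp add: x sum_distrib_left sum_distrib_right power_add mult_ac)
    finally show ?thesis .
  qed
  have "B *\<^sub>v v = ?x \<cdot>\<^sub>v v"
  proof (rule eq_vecI)
    fix i assume "i < dim_vec (?x \<cdot>\<^sub>v v)"
    then have i: "i < N" by (simp add: v_def)
    then have "(B *\<^sub>v v) $ i = (\<Sum>l<N. of_int (\<Sum>j\<in>{j. j \<le> degree g \<and> (i + j) mod N = l}. coeff g j) * \<zeta> ^ l)"
      by (simp add: B_def A_def v_def scalar_prod_def lessThan_atLeast0)
    then show "(B *\<^sub>v v) $ i = (?x \<cdot>\<^sub>v v) $ i"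
      using row i by (simp add: v_def)
  qed (simp add: v_def B_def A_def)
  moreover have "v \<noteq> 0\<^sub>v N"
  proof
    assume "v = 0\<^sub>v N"
    then have "v $ 0 = 0" using N by simp
    then show False using N by (simp add: v_def)
  qed
  moreover have "v \<in> carrier_vec N" by (simp add: v_def)
  ultimately have "eigenvalue B ?x"
    using B unfolding eigenvalue_def eigenvector_def by auto
  then have "poly (char_poly B) ?x = 0" using eigenvalue_root_char_poly[OF B] by blast
  then have "poly (map_poly of_int (char_poly A)) ?x = 0"
    by (simp add: B_def of_int_hom.char_poly_hom[OF A])
  then have "algebraic_int ?x"
    using degree_monic_char_poly[OF A] by (auto simp: algebraic_int_altdef_ipoly)
  moreover have eq: "?x = 1 / of_nat p"
    using unit p by (simp add: field_simps)
  ultimately have "?x \<in> \<int>"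
    by (intro rational_algebraic_int_is_int) auto
  then obtain a :: int where "?x = of_int a" by (auto elim: Ints_cases)
  with unit have "of_int (int p * a) = (of_int 1 :: complex)" by simp
  then have "int p * a = 1" unfolding of_int_eq_iff .
  then show False using p by (auto simp: zmult_eq_1_iff)
qed

text \<open>
  Ideals of a ring that is given as a type. The field constructed below is the quotient of the type
  \<^typ>\<open>int poly\<close> by such an ideal, but the quotient is never formed: computing with congruences keeps
  the ring operations of the type, and with them its arithmetic automation.
\<close>

definition ring_ideal :: "'a :: comm_ring_1 set \<Rightarrow> bool" where
  "ring_ideal I \<longleftrightarrow> 0 \<in> I \<and> (\<forall>x\<in>I. \<forall>y\<in>I. x + y \<in> I) \<and> (\<forall>x\<in>I. \<forall>r. r * x \<in> I)"

lemma ring_ideal_0: "ring_ideal I \<Longrightarrow> 0 \<in> I"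
  and ring_ideal_add: "ring_ideal I \<Longrightarrow> x \<in> I \<Longrightarrow> y \<in> I \<Longrightarrow> x + y \<in> I"
  and ring_ideal_mult: "ring_ideal I \<Longrightarrow> x \<in> I \<Longrightarrow> r * x \<in> I"
  by (auto simp: ring_ideal_def)

lemma ring_ideal_diff:
  assumes "ring_ideal I" "x \<in> I" "y \<in> I"
  shows "x - y \<in> I"
  using ring_ideal_add[OF assms(1,2) ring_ideal_mult[OF assms(1,3), of "-1"]] by simp

lemma ring_ideal_sum:
  assumes "ring_ideal I" "\<And>a. a \<in> A \<Longrightarrow> f a \<in> I"
  shows "sum f A \<in> I"
  using assms(2)
  by (induction A rule: infinite_finite_induct) (auto simp: ring_ideal_0 ring_ideal_add assms(1))

lemma maximal_ideal_exists:
  fixes I :: "'a :: comm_ring_1 set"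
  assumes I: "ring_ideal I" "1 \<notin> I"
  obtains M where "ring_ideal M" "I \<subseteq> M" "1 \<notin> M" "\<And>x. x \<notin> M \<Longrightarrow> \<exists>y. x * y - 1 \<in> M"
proof -
  define \<A> where "\<A> = {J. ring_ideal J \<and> I \<subseteq> J \<and> 1 \<notin> J}"
  have "\<exists>M\<in>\<A>. \<forall>J\<in>\<A>. M \<subseteq> J \<longrightarrow> J = M"
  proof (rule subset_Zorn_nonempty)
    show "\<A> \<noteq> {}" using I by (auto simp: \<A>_def)
  next
    fix \<C> assume C: "\<C> \<noteq> {}" "subset.chain \<A> \<C>"
    then have sub: "\<C> \<subseteq> \<A>" and lin: "\<And>J K. J \<in> \<C> \<Longrightarrow> K \<in> \<C> \<Longrightarrow> J \<subseteq> K \<or> K \<subseteq> J"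
      by (auto simp: subset_chain_def)
    have "x + y \<in> \<Union>\<C>" if "x \<in> \<Union>\<C>" "y \<in> \<Union>\<C>" for x y
    proof -
      obtain J K where JK: "J \<in> \<C>" "x \<in> J" "K \<in> \<C>" "y \<in> K" using \<open>x \<in> \<Union>\<C>\<close> \<open>y \<in> \<Union>\<C>\<close> by auto
      then obtain L where "L \<in> \<C>" "x \<in> L" "y \<in> L" using lin[of J K] by blast
      moreover have "ring_ideal L" using \<open>L \<in> \<C>\<close> sub by (auto simp: \<A>_def)
      ultimately show ?thesis by (auto intro: ring_ideal_add)
    qed
    moreover have "r * x \<in> \<Union>\<C>" if "x \<in> \<Union>\<C>" for r x
      using that sub by (auto simp: \<A>_def intro: ring_ideal_mult)
    moreover have "0 \<in> \<Union>\<C>"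
      using C(1) sub by (auto simp: \<A>_def intro: ring_ideal_0)
    ultimately have "ring_ideal (\<Union>\<C>)" by (simp add: ring_ideal_def del: Union_iff)
    then show "\<Union>\<C> \<in> \<A>" using C(1) sub by (auto simp: \<A>_def)
  qed
  then obtain M where M: "M \<in> \<A>" and max: "\<And>J. J \<in> \<A> \<Longrightarrow> M \<subseteq> J \<Longrightarrow> J = M" by blast
  have id: "ring_ideal M" using M by (simp add: \<A>_def)
  \<comment> \<open>An element outside \<open>M\<close> without an inverse would generate, with \<open>M\<close>, a larger proper ideal.\<close>
  have "\<exists>y. x * y - 1 \<in> M" if x: "x \<notin> M" for x
  proof (rule ccontr)
    assume no: "\<not> (\<exists>y. x * y - 1 \<in> M)"
    define J where "J = {m + r * x | m r. m \<in> M}"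
    have "ring_ideal J"
      unfolding ring_ideal_def
    proof (intro conjI ballI allI)
      have "0 + 0 * x \<in> J" unfolding J_def using ring_ideal_0[OF id] by blast
      then show "0 \<in> J" by simp
    next
      fix a b assume "a \<in> J" "b \<in> J"
      then obtain m r m' r' where "a = m + r * x" "m \<in> M" "b = m' + r' * x" "m' \<in> M"
        by (auto simp: J_def)
      then have "a + b = (m + m') + (r + r') * x" "m + m' \<in> M"
        using ring_ideal_add[OF id] by (auto simp: algebra_simps)
      then show "a + b \<in> J" unfolding J_def by blast
    next
      fix a s assume "a \<in> J"
      then obtain m r where "a = m + r * x" "m \<in> M" by (auto simp: J_def)
      then have "s * a = s * m + (s * r) * x" "s * m \<in> M"
        using ring_ideal_mult[OF id] by (auto simp: algebra_simps)
      then show "s * a \<in> J" unfolding J_def by blast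
    qed
    moreover have MJ: "M \<subseteq> J"
    proof
      fix m assume "m \<in> M"
      then have "m + 0 * x \<in> J" unfolding J_def by blast
      then show "m \<in> J" by simp
    qed
    moreover have "1 \<notin> J"
    proof
      assume "1 \<in> J"
      then obtain m r where "1 = m + r * x" "m \<in> M" by (auto simp: J_def)
      then have "x * r - 1 = (-1) * m" by (simp add: algebra_simps)
      then have "x * r - 1 \<in> M" using ring_ideal_mult[OF id \<open>m \<in> M\<close>, of "-1"] by (simp only:)
      then show False using no by blast
    qed
    ultimately have "J = M" using M by (intro max) (auto simp: \<A>_def)
    moreover have "0 + 1 * x \<in> J" unfolding J_def using ring_ideal_0[OF id] by blast
    ultimately show False using x by simp
  qed
  then show ?thesis using that M by (auto simp: \<A>_def)
qed

definition ideal_cong :: "'a :: comm_ring_1 set \<Rightarrow> 'a \<Rightarrow> 'a \<Rightarrow> bool" where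
  "ideal_cong I x y \<longleftrightarrow> x - y \<in> I"

lemma ideal_cong_refl: "ring_ideal I \<Longrightarrow> ideal_cong I x x"
  by (simp add: ideal_cong_def ring_ideal_0)

lemma ideal_cong_sym: "ring_ideal I \<Longrightarrow> ideal_cong I x y \<Longrightarrow> ideal_cong I y x"
  using ring_ideal_diff[of I 0 "x - y"] by (simp add: ideal_cong_def ring_ideal_0)

lemma ideal_cong_trans:
  "ring_ideal I \<Longrightarrow> ideal_cong I x y \<Longrightarrow> ideal_cong I y z \<Longrightarrow> ideal_cong I x z"
  using ring_ideal_add[of I "x - y" "y - z"] by (simp add: ideal_cong_def)

lemma ideal_cong_add:
  "ring_ideal I \<Longrightarrow> ideal_cong I x y \<Longrightarrow> ideal_cong I x' y' \<Longrightarrow> ideal_cong I (x + x') (y + y')"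
  using ring_ideal_add[of I "x - y" "x' - y'"] by (simp add: ideal_cong_def algebra_simps)

lemma ideal_cong_mult:
  assumes "ring_ideal I" "ideal_cong I x y" "ideal_cong I x' y'"
  shows "ideal_cong I (x * x') (y * y')"
proof -
  have "x' * (x - y) + y * (x' - y') \<in> I"
    using assms by (auto simp: ideal_cong_def intro: ring_ideal_add ring_ideal_mult)
  then show ?thesis by (simp add: ideal_cong_def algebra_simps)
qed

lemma ideal_cong_power:
  "ring_ideal I \<Longrightarrow> ideal_cong I x y \<Longrightarrow> ideal_cong I (x ^ n) (y ^ n)"
  by (induction n) (auto intro: ideal_cong_refl ideal_cong_mult)

text \<open>
  In the binomial expansion of a \<open>p\<close>-th power all middle coefficients are multiples of \<open>p\<close>, so
  raising to the power \<open>p\<close> is additive modulo \<open>I\<close>; iterate this \<open>m\<close> times.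
\<close>

lemma ideal_cong_frobenius:
  fixes I :: "'a :: comm_ring_1 set"
  assumes I: "ring_ideal I" and p: "prime p" "of_nat p \<in> I"
  shows "ideal_cong I ((x + y) ^ (p ^ m)) (x ^ (p ^ m) + y ^ (p ^ m))"
proof (induction m)
  case 0
  then show ?case by (simp add: ideal_cong_refl[OF I])
next
  case (Suc m)
  have step: "ideal_cong I ((a + b) ^ p) (a ^ p + b ^ p)" for a b :: 'a
  proof -
    let ?t = "\<lambda>k. of_nat (p choose k) * a ^ k * b ^ (p - k)"
    have p0: "p > 0" using p(1) prime_gt_0_nat by blast
    have "(a + b) ^ p = (\<Sum>k\<le>p. ?t k)" by (rule binomial_ring)
    also have "{..p} = insert 0 (insert p {1..<p})" using p0 by auto
    also have "sum ?t \<dots> = a ^ p + b ^ p + (\<Sum>k=1..<p. ?t k)"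
      using p0 by (subst sum.insert; auto)+
    finally have "(a + b) ^ p - (a ^ p + b ^ p) = (\<Sum>k=1..<p. ?t k)" by simp
    also have "\<dots> \<in> I"
    proof (rule ring_ideal_sum[OF I])
      fix k assume "k \<in> {1..<p}"
      then have "p dvd (p choose k)" using p0 p(1) by (intro dvd_choose_prime) auto
      then obtain c where "p choose k = p * c" by (elim dvdE)
      then have "?t k = (of_nat c * a ^ k * b ^ (p - k)) * of_nat p" by (simp add: algebra_simps)
      then show "?t k \<in> I" using ring_ideal_mult[OF I p(2)] by simp
    qed
    finally show ?thesis by (simp add: ideal_cong_def)
  qed
  have "(x + y) ^ p ^ Suc m = ((x + y) ^ p ^ m) ^ p" by (simp add: mult.commute flip: power_mult)
  moreover have "ideal_cong I (((x + y) ^ p ^ m) ^ p) ((x ^ p ^ m + y ^ p ^ m) ^ p)"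
    by (rule ideal_cong_power[OF I Suc.IH])
  moreover note step[of "x ^ p ^ m" "y ^ p ^ m"]
  moreover have "(x ^ p ^ m) ^ p + (y ^ p ^ m) ^ p = x ^ p ^ Suc m + y ^ p ^ Suc m"
    by (simp add: mult.commute flip: power_mult)
  ultimately show ?case using ideal_cong_trans[OF I] by metis
qed


text \<open>
  Both sides are monic polynomials in \<open>y\<close> of degree \<open>N\<close> that vanish at the \<open>N\<close> roots of unity.
\<close>

lemma power_minus_1_eq_prod_roots_of_unity:
  fixes y :: complex
  assumes N: "N > 0"
  defines "\<zeta> \<equiv> cis (2 * pi / real N)"
  shows "y ^ N - 1 = (\<Prod>i<N. y - \<zeta> ^ i)"
proof -
  define P where "P = (\<Prod>i<N. [:- (\<zeta> ^ i), 1:])"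
  define Q :: "complex poly" where "Q = monom 1 N - 1"
  have pow: "\<zeta> ^ i = cis (2 * pi * real i / real N)" for i
    by (simp add: \<zeta>_def DeMoivre mult_ac)
  have bij: "bij_betw (\<lambda>i. \<zeta> ^ i) {..<N} {z. z ^ N = 1}"
    unfolding pow by (rule bij_betw_roots_unity[OF N])
  have degP: "degree P = N"
    unfolding P_def by (subst degree_prod_eq_sum_degree) auto
  have degQ: "degree Q \<le> N"
    unfolding Q_def by (intro degree_diff_le degree_monom_le) simp
  have "Q = P"
  proof (rule poly_eqI_degree_lead_coeff)
    show "degree Q \<le> N" "degree P \<le> N" by (simp_all add: degP degQ)
    show "coeff Q N = coeff P N"
      using degP lead_coeff_prod[of "\<lambda>i. [:- (\<zeta> ^ i), 1:]" "{..<N}"] N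
      by (simp add: P_def Q_def)
    show "N \<le> card {z::complex. z ^ N = 1}" by (simp add: card_roots_unity_eq[OF N])
    show "poly Q z = poly P z" if "z \<in> {z. z ^ N = 1}" for z
    proof -
      have "z \<in> (\<lambda>i. \<zeta> ^ i) ` {..<N}" using that bij by (simp add: bij_betw_def)
      then have "poly P z = 0" by (auto simp: P_def poly_prod)
      then show ?thesis using that by (simp add: Q_def poly_monom)
    qed
  qed
  then have "poly Q y = poly P y" by simp
  then show ?thesis by (simp add: P_def Q_def poly_monom poly_prod)
qed

text \<open>
  The field with \<open>q = p\<^bsup>m\<^esup>\<close> elements is a residue field of the cyclotomic ring \<open>\<int>[\<zeta>]\<close>, where \<open>\<zeta>\<close> is
  a complex root of unity of exact order \<open>N = q - 1\<close>. Write \<open>\<int>[\<zeta>]\<close> as a quotient of \<open>\<int>[X]\<close>. Since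
  \<open>p\<close> is not a unit in \<open>\<int>[\<zeta>]\<close>, some maximal ideal \<open>M\<close> of \<open>\<int>[X]\<close> contains \<open>p\<close> and all polynomials
  that vanish at \<open>\<zeta>\<close>. The elements \<open>0, 1, X, \<dots>, X\<^bsup>N-1\<^esup>\<close> represent every residue class exactly once:

  \<^item> Every \<open>f\<close> satisfies \<open>f\<^bsup>q\<^esup> \<equiv> f\<close>, by the Frobenius congruence and \<open>X\<^bsup>q\<^esup> \<equiv> X\<close>. As
    \<open>y\<^bsup>q\<^esup> - y = y \<Prod>\<^sub>i (y - \<zeta>\<^bsup>i\<^esup>)\<close> holds in \<open>\<complex>\<close>, the product \<open>f \<Prod>\<^sub>i (f - X\<^bsup>i\<^esup>)\<close> lies in the prime
    ideal \<open>M\<close>, hence one of its factors does.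
  \<^item> If \<open>X\<^bsup>d\<^esup> \<equiv> 1\<close> with \<open>0 < d < N\<close>, then the geometric sum \<open>\<Sum>\<^bsub>l<N\<^esub> X\<^bsup>dl\<^esup>\<close> is congruent to \<open>N\<close>. But
    it vanishes at \<open>\<zeta>\<close>, so \<open>N = q - 1\<close> would lie in \<open>M\<close>, and with it \<open>1\<close>.
\<close>

lemma finite_field_of_prime_power_order:
  fixes p m :: nat
  assumes p: "prime p" and m: "m > 0"
  obtains M :: "int poly set" and t :: "nat \<Rightarrow> int poly"
  where "ring_ideal M"
    and "\<And>x. x \<notin> M \<Longrightarrow> \<exists>y. x * y - 1 \<in> M"
    and "\<And>f. \<exists>i < p ^ m. ideal_cong M f (t i)"
    and "\<And>i j. i < p ^ m \<Longrightarrow> j < p ^ m \<Longrightarrow> ideal_cong M (t i) (t j) \<Longrightarrow> i = j"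
proof -
  define q where "q = p ^ m"
  define N where "N = q - 1"
  have p1: "p > 1" using p prime_gt_1_nat by blast
  then have "q > 1" unfolding q_def using m by (rule one_less_power)
  then have N: "N > 0" and qN: "q = Suc N" by (auto simp: N_def)
  define \<zeta> where "\<zeta> = cis (2 * pi / real N)"
  have root: "\<zeta> ^ N = 1" using N by (simp add: \<zeta>_def DeMoivre)
  have pow: "\<zeta> ^ i = cis (2 * pi * real i / real N)" for i
    by (simp add: \<zeta>_def DeMoivre mult_ac)
  have inj: "inj_on (\<lambda>i. \<zeta> ^ i) {..<N}"
    unfolding pow using bij_betw_roots_unity[OF N] by (simp add: bij_betw_def)
  define ev :: "int poly \<Rightarrow> complex" where "ev f = poly (map_poly of_int f) \<zeta>" for f
  have ev_add: "ev (f + g) = ev f + ev g" and ev_mult: "ev (f * g) = ev f * ev g"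
    and ev_1: "ev 1 = 1" and ev_0: "ev 0 = 0" and ev_uminus: "ev (- f) = - ev f" for f g
    by (simp_all add: ev_def hom_distribs)
  have ev_diff: "ev (f - g) = ev f - ev g" for f g
    using ev_add[of f "- g"] by (simp add: ev_uminus)
  have ev_power: "ev (f ^ n) = ev f ^ n" for f n
    by (induction n) (simp_all add: ev_1 ev_mult)
  have ev_sum: "ev (sum f A) = (\<Sum>a\<in>A. ev (f a))" for f and A :: "nat set"
    by (induction A rule: infinite_finite_induct) (simp_all add: ev_0 ev_add)
  have ev_prod: "ev (prod f A) = (\<Prod>a\<in>A. ev (f a))" for f and A :: "nat set"
    by (induction A rule: infinite_finite_induct) (simp_all add: ev_1 ev_mult)
  have ev_nat: "ev (of_nat n) = of_nat n" for n
    by (induction n) (simp_all add: ev_0 ev_1 ev_add)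
  define X :: "int poly" where "X = [:0, 1:]"
  have ev_X: "ev X = \<zeta>" by (simp add: ev_def X_def)

  \<comment> \<open>\<open>I\<close> is the ideal generated by \<open>p\<close> and the kernel of the evaluation at \<open>\<zeta>\<close>.\<close>
  define I where "I = {f. \<exists>g. ev f = of_nat p * ev g}"
  have "ring_ideal I"
    unfolding ring_ideal_def
  proof (intro conjI ballI allI)
    show "0 \<in> I" using ev_0 by (auto simp: I_def intro!: exI[of _ 0])
  next
    fix f f' assume "f \<in> I" "f' \<in> I"
    then obtain g g' where "ev f = of_nat p * ev g" "ev f' = of_nat p * ev g'" by (auto simp: I_def)
    then have "ev (f + f') = of_nat p * ev (g + g')" by (simp add: ev_add algebra_simps)
    then show "f + f' \<in> I" by (auto simp: I_def)
  next
    fix f r assume "f \<in> I"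
    then obtain g where "ev f = of_nat p * ev g" by (auto simp: I_def)
    then have "ev (r * f) = of_nat p * ev (r * g)" by (simp add: ev_mult algebra_simps)
    then show "r * f \<in> I" by (auto simp: I_def)
  qed
  moreover have "1 \<notin> I"
  proof
    assume "1 \<in> I"
    then obtain g where "of_nat p * poly (map_poly of_int g) \<zeta> = 1" by (auto simp: I_def ev_1) (simp add: ev_def)
    then show False using prime_not_unit_in_cyclotomic_ring[OF root N p1] by blast
  qed
  ultimately obtain M where M: "ring_ideal M" and IM: "I \<subseteq> M" and M1: "1 \<notin> M"
    and inv: "\<And>x. x \<notin> M \<Longrightarrow> \<exists>y. x * y - 1 \<in> M"
    using maximal_ideal_exists by blast
  have ker: "f \<in> M" if "ev f = 0" for f
    using that IM ev_0 by (auto simp: I_def intro!: exI[of _ 0])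
  have pM: "of_nat p \<in> M"
  proof -
    have "ev (of_nat p) = of_nat p * ev 1" by (simp add: ev_nat ev_1)
    then show ?thesis using IM by (auto simp: I_def)
  qed
  note refl = ideal_cong_refl[OF M] and sym = ideal_cong_sym[OF M] and trans = ideal_cong_trans[OF M]
  \<comment> \<open>Being maximal, \<open>M\<close> is prime.\<close>
  have dom: "x \<in> M \<or> y \<in> M" if "x * y \<in> M" for x y
  proof (rule disjCI)
    assume "y \<notin> M"
    then obtain z where "y * z - 1 \<in> M" using inv by blast
    then have "z * (x * y) - x * (y * z - 1) \<in> M"
      using that ring_ideal_diff[OF M] ring_ideal_mult[OF M] by blast
    then show "x \<in> M" by (simp add: algebra_simps)
  qed
  have dom_prod: "\<exists>i\<in>A. f i \<in> M" if "finite A" "prod f A \<in> M" for f and A :: "nat set"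
    using that
  proof (induction A)
    case empty
    then show ?case using M1 by simp
  next
    case (insert a A)
    then show ?case using dom[of "f a" "prod f A"] by auto
  qed

  have fermat: "ideal_cong M (f ^ q) f" for f
  proof (induction f)
    case 0
    then show ?case by (simp add: refl qN)
  next
    case (pCons a f)
    have "ideal_cong M ([:a:] ^ q) [:a:]"
    proof -
      have nat: "ideal_cong M (of_nat n ^ q) (of_nat n)" for n
      proof (induction n)
        case 0
        then show ?case by (simp add: refl qN)
      next
        case (Suc n)
        have "ideal_cong M ((1 + of_nat n) ^ q) (1 ^ q + of_nat n ^ q)"
          unfolding q_def by (rule ideal_cong_frobenius[OF M p pM])
        moreover have "ideal_cong M (1 ^ q + of_nat n ^ q) (1 + of_nat n)"
          using ideal_cong_add[OF M refl[of 1] Suc.IH] by simp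
        ultimately show ?case using trans by simp
      qed
      obtain b where b: "ideal_cong M [:a:] (of_nat b)"
      proof -
        define b where "b = nat (a mod int p)"
        have "a = (a div int p) * int p + int b" using p1 by (simp add: b_def)
        then have "of_int a = (of_int ((a div int p) * int p + int b) :: int poly)" by (rule arg_cong)
        also have "\<dots> = of_int (a div int p) * of_nat p + of_nat b"
          by (simp only: of_int_add of_int_mult of_int_of_nat_eq)
        finally have "[:a:] - of_nat b = of_int (a div int p) * of_nat p" by (simp add: of_int_poly)
        then have "ideal_cong M [:a:] (of_nat b)"
          unfolding ideal_cong_def using ring_ideal_mult[OF M pM] by (simp only:)
        then show ?thesis by (rule that)
      qed
      show ?thesis
        using trans[OF trans[OF ideal_cong_power[OF M b, of q] nat] sym[OF b]] .
    qed
    moreover have "ideal_cong M ((X * f) ^ q) (X * f)"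
    proof -
      have "ev (X ^ q - X) = 0" using root by (simp add: ev_diff ev_mult ev_power ev_X qN)
      then have "ideal_cong M (X ^ q) X" using ker by (simp add: ideal_cong_def)
      then show ?thesis using ideal_cong_mult[OF M _ pCons.IH] by (simp add: power_mult_distrib)
    qed
    ultimately have "ideal_cong M ([:a:] ^ q + (X * f) ^ q) ([:a:] + X * f)"
      by (rule ideal_cong_add[OF M])
    moreover have "pCons a f = [:a:] + X * f" by (simp add: X_def)
    moreover have "ideal_cong M (([:a:] + X * f) ^ q) ([:a:] ^ q + (X * f) ^ q)"
      unfolding q_def by (rule ideal_cong_frobenius[OF M p pM])
    ultimately show ?case using trans by metis
  qed

  \<comment> \<open>The index \<open>N\<close>, which is not used up by the powers of \<open>X\<close>, represents zero.\<close>
  define t where "t i = (if i < N then X ^ i else 0)" for i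
  have surj: "\<exists>i<q. ideal_cong M f (t i)" for f
  proof -
    have "ev (f ^ q - f - f * (\<Prod>i<N. f - X ^ i)) = 0"
    proof -
      have "(\<Prod>i<N. ev f - \<zeta> ^ i) = ev f ^ N - 1"
        unfolding \<zeta>_def by (rule power_minus_1_eq_prod_roots_of_unity[OF N, symmetric])
      then show ?thesis by (simp add: ev_diff ev_mult ev_prod ev_power ev_X qN right_diff_distrib)
    qed
    then have "f ^ q - f - f * (\<Prod>i<N. f - X ^ i) \<in> M" by (rule ker)
    moreover have "f ^ q - f \<in> M" using fermat[of f] by (simp add: ideal_cong_def)
    ultimately have "(f ^ q - f) - (f ^ q - f - f * (\<Prod>i<N. f - X ^ i)) \<in> M"
      using ring_ideal_diff[OF M] by blast
    then have "f * (\<Prod>i<N. f - X ^ i) \<in> M" by simp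
    then consider "f \<in> M" | i where "i < N" "f - X ^ i \<in> M"
      using dom dom_prod[of "{..<N}"] by blast
    then show ?thesis
    proof cases
      case 1
      then show ?thesis by (intro exI[of _ N]) (simp add: t_def qN ideal_cong_def)
    next
      case 2
      then show ?thesis by (intro exI[of _ i]) (simp add: t_def qN ideal_cong_def)
    qed
  qed
  have unit_X: "X ^ i \<notin> M" if "i \<le> N" for i
  proof
    assume "X ^ i \<in> M"
    then have "X ^ (N - i) * X ^ i \<in> M" by (rule ring_ideal_mult[OF M])
    then have "X ^ N \<in> M" using that by (simp flip: power_add)
    moreover have "X ^ N - 1 \<in> M" by (rule ker) (simp add: ev_diff ev_power ev_X ev_1 root)
    ultimately have "X ^ N - (X ^ N - 1) \<in> M" by (rule ring_ideal_diff[OF M])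
    then show False using M1 by simp
  qed
  have N_notin: "of_nat N \<notin> M"
  proof
    assume "of_nat N \<in> M"
    moreover have "of_nat (p ^ (m - 1)) * of_nat p \<in> M" by (rule ring_ideal_mult[OF M pM])
    then have "of_nat q \<in> M" using m by (cases m) (simp_all add: q_def mult.commute)
    ultimately have "of_nat q - of_nat N \<in> M" using ring_ideal_diff[OF M] by blast
    then show False using M1 by (simp add: qN)
  qed
  have X_inj: "\<not> ideal_cong M (X ^ j) (X ^ i)" if "i < j" "j < N" for i j
  proof
    assume "ideal_cong M (X ^ j) (X ^ i)"
    then have "X ^ i * (X ^ (j - i) - 1) \<in> M"
      using \<open>i < j\<close> by (simp add: ideal_cong_def right_diff_distrib flip: power_add)
    then have d: "ideal_cong M (X ^ (j - i)) 1"
      using dom unit_X[of i] that by (auto simp: ideal_cong_def)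
    define \<omega> where "\<omega> = \<zeta> ^ (j - i)"
    have "\<omega> \<noteq> 1"
    proof
      assume "\<omega> = 1"
      then have "\<zeta> ^ (j - i) = \<zeta> ^ 0" by (simp add: \<omega>_def)
      moreover have "j - i < N" using that by linarith
      ultimately have "j - i = 0" using inj_onD[OF inj, of "j - i" 0] N by simp
      then show False using that by simp
    qed
    moreover have "\<omega> ^ N = 1" by (metis \<omega>_def root power_mult mult.commute power_one)
    ultimately have "(\<Sum>l<N. \<omega> ^ l) = 0" by (simp add: geometric_sum)
    then have "(\<Sum>l<N. (X ^ (j - i)) ^ l) \<in> M"
      by (intro ker) (simp add: ev_sum ev_power ev_X \<omega>_def)
    moreover have "(\<Sum>l<N. (X ^ (j - i)) ^ l - 1 ^ l) \<in> M"
      using ideal_cong_power[OF M d] by (intro ring_ideal_sum[OF M]) (simp add: ideal_cong_def)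
    ultimately have "(\<Sum>l<N. (X ^ (j - i)) ^ l) - (\<Sum>l<N. (X ^ (j - i)) ^ l - 1 ^ l) \<in> M"
      by (rule ring_ideal_diff[OF M])
    then show False using N_notin by (simp add: sum_subtractf)
  qed
  have t_inj: "i = j" if "i < q" "j < q" "ideal_cong M (t i) (t j)" for i j
  proof (rule ccontr)
    assume "i \<noteq> j"
    have no: "\<not> ideal_cong M (t b) (t a)" if "a < b" "b < q" for a b
    proof (cases "b < N")
      case True
      then show ?thesis using X_inj that by (simp add: t_def)
    next
      case False
      then have "b = N" "a < N" using that by (auto simp: qN)
      then show ?thesis
        using unit_X[of a] sym[of 0 "X ^ a"] by (auto simp: t_def ideal_cong_def)
    qed
    show False using no[of i j] no[of j i] sym[OF that(3)] that \<open>i \<noteq> j\<close> by (metis linorder_neqE_nat)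
  qed
  show ?thesis
    using that[OF M inv, of t] surj t_inj unfolding q_def by blast
qed

section \<open>Projective planes of prime power order\<close>

text \<open>
  A projective plane can be coordinatised by the ternary operation \<open>T m x b = m x + b\<close>, and the only
  properties of the field that the incidence argument uses are the solvability statements below. The
  one-element set with its trivial operation has them too. Thus the triangle, the plane of order 1,
  arises from the same construction as the planes over finite fields.
\<close>

lemma ternary_function_exists:
  assumes "prime_power_or_one q"
  obtains T :: "nat \<Rightarrow> nat \<Rightarrow> nat \<Rightarrow> nat"
  where "\<And>m x y. m < q \<Longrightarrow> x < q \<Longrightarrow> y < q \<Longrightarrow> \<exists>b<q. T m x b = y"
    and "\<And>x x' y y'. x < q \<Longrightarrow> x' < q \<Longrightarrow> y < q \<Longrightarrow> y' < q \<Longrightarrow> x \<noteq> x' \<Longrightarrow>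
           \<exists>m<q. \<exists>b<q. T m x b = y \<and> T m x' b = y'"
proof (cases "q = 1")
  case True
  then show ?thesis using that[of "\<lambda>_ _ _. 0"] by simp
next
  case False
  then have "primepow q" using assms by (simp add: prime_power_or_one_def)
  then obtain p m where "prime p" "m > 0" and q: "q = p ^ m" by (auto simp: primepow_def)
  then obtain M and t :: "nat \<Rightarrow> int poly" where M: "ring_ideal M"
    and inv: "\<And>x. x \<notin> M \<Longrightarrow> \<exists>y. x * y - 1 \<in> M"
    and rep: "\<And>f. \<exists>i<q. ideal_cong M f (t i)"
    and inj: "\<And>i j. i < q \<Longrightarrow> j < q \<Longrightarrow> ideal_cong M (t i) (t j) \<Longrightarrow> i = j"
    using finite_field_of_prime_power_order[of p m] by metis
  note refl = ideal_cong_refl[OF M] and sym = ideal_cong_sym[OF M] and trans = ideal_cong_trans[OF M]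
  obtain r where r: "\<And>f. r f < q" "\<And>f. ideal_cong M f (t (r f))" using rep by metis
  have r_eq: "r f = i" if "i < q" "ideal_cong M f (t i)" for f i
    using inj[OF r(1) that(1) trans[OF sym[OF r(2)] that(2)]] .
  define T where "T m x b = r (t m * t x + t b)" for m x b
  show ?thesis
  proof (rule that[of T])
    fix m x y assume y: "y < q"
    define b where "b = r (t y - t m * t x)"
    have "ideal_cong M (t b) (t y - t m * t x)" unfolding b_def by (rule sym[OF r(2)])
    then have "ideal_cong M (t m * t x + t b) (t m * t x + (t y - t m * t x))"
      by (rule ideal_cong_add[OF M refl])
    then have "T m x b = y" unfolding T_def by (intro r_eq[OF y]) simp
    then show "\<exists>b<q. T m x b = y" using r(1) by (auto simp: b_def)
  next
    fix x x' y y' assume lt: "x < q" "x' < q" "y < q" "y' < q" and "x \<noteq> x'"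
    then have "t x - t x' \<notin> M" using inj by (auto simp: ideal_cong_def)
    then obtain z where "(t x - t x') * z - 1 \<in> M" using inv by blast
    then have z: "ideal_cong M ((t x - t x') * z) 1" by (simp add: ideal_cong_def)
    \<comment> \<open>\<open>m\<close> is the slope \<open>(y - y') / (x - x')\<close>, as \<open>z\<close> represents the inverse of \<open>x - x'\<close>.\<close>
    define m where "m = r (z * (t y - t y'))"
    define b where "b = r (t y - t m * t x)"
    have m: "ideal_cong M (t m) (z * (t y - t y'))" unfolding m_def by (rule sym[OF r(2)])
    have b: "ideal_cong M (t b) (t y - t m * t x)" unfolding b_def by (rule sym[OF r(2)])
    have b': "ideal_cong M (t m * t x + t b) (t m * t x + (t y - t m * t x))"
      by (rule ideal_cong_add[OF M refl b])
    then have 1: "T m x b = y" unfolding T_def by (intro r_eq[OF lt(3)]) simp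
    have "ideal_cong M ((t x' - t x) * t m) ((t x' - t x) * (z * (t y - t y')))"
      by (rule ideal_cong_mult[OF M refl m])
    moreover have "ideal_cong M (((t x - t x') * z) * (t y' - t y)) (1 * (t y' - t y))"
      by (rule ideal_cong_mult[OF M z refl])
    ultimately have "ideal_cong M ((t x' - t x) * t m) (t y' - t y)"
      using trans by (simp add: algebra_simps)
    then have "ideal_cong M ((t x' - t x) * t m + (t m * t x + t b))
        ((t y' - t y) + (t m * t x + (t y - t m * t x)))"
      by (rule ideal_cong_add[OF M _ b'])
    then have "T m x' b = y'" unfolding T_def by (intro r_eq[OF lt(4)]) (simp add: algebra_simps)
    with 1 show "\<exists>m<q. \<exists>b<q. T m x b = y \<and> T m x' b = y'"
      using r(1) by (auto simp: m_def b_def)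
  qed
qed

text \<open>
  The points are the \<open>q\<^sup>2\<close> affine points \<open>(x, y)\<close>, the \<open>q\<close> slopes and one further point at infinity;
  the lines are \<open>y = m x + b\<close> completed by the slope \<open>m\<close>, the vertical lines completed by the
  further point, and the line at infinity. Points and lines are then numbered, the points from 0
  (they become residues modulo \<open>q\<^sup>2 + q + 1\<close>) and the lines from 1 (they become colours). The
  colouring needs an upper bound on the size of a line and, for any two points, a line through both.
\<close>

lemma projective_plane_exists:
  assumes "prime_power_or_one q"
  obtains l :: "nat \<Rightarrow> nat set"
  where "\<And>i. l i \<subseteq> {..<q\<^sup>2 + q + 1}"
    and "\<And>i. card (l i) \<le> q + 1"
    and "\<And>x y. x < q\<^sup>2 + q + 1 \<Longrightarrow> y < q\<^sup>2 + q + 1 \<Longrightarrow> \<exists>i\<in>{1..q\<^sup>2 + q + 1}. x \<in> l i \<and> y \<in> l i"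
proof -
  obtain T :: "nat \<Rightarrow> nat \<Rightarrow> nat \<Rightarrow> nat" where
        T1: "\<And>m x y. m < q \<Longrightarrow> x < q \<Longrightarrow> y < q \<Longrightarrow> \<exists>b<q. T m x b = y"
    and T2: "\<And>x x' y y'. x < q \<Longrightarrow> x' < q \<Longrightarrow> y < q \<Longrightarrow> y' < q \<Longrightarrow> x \<noteq> x' \<Longrightarrow>
           \<exists>m<q. \<exists>b<q. T m x b = y \<and> T m x' b = y'"
    using ternary_function_exists[OF assms] by blast
  define S :: "(nat \<times> nat + nat + unit) set" where
    "S = ({..<q} \<times> {..<q}) <+> ({..<q} <+> {()})"
  define L :: "nat \<times> nat + nat + unit \<Rightarrow> (nat \<times> nat + nat + unit) set" where
    "L i = (case i of
       Inl (m, b) \<Rightarrow> insert (Inr (Inl m)) ((\<lambda>x. Inl (x, T m x b)) ` {..<q})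
     | Inr (Inl c) \<Rightarrow> insert (Inr (Inr ())) ((\<lambda>y. Inl (c, y)) ` {..<q})
     | Inr (Inr u) \<Rightarrow> insert (Inr (Inr ())) ((\<lambda>m. Inr (Inl m)) ` {..<q}))" for i
  have fin: "finite S" by (simp add: S_def)
  have card_S: "card S = q\<^sup>2 + q + 1" by (simp add: S_def card_Plus power2_eq_square)
  have card_insert_image: "card (insert a (f ` {..<q})) \<le> Suc q"
    for a and f :: "nat \<Rightarrow> nat \<times> nat + nat + unit"
    using card_image_le[of "{..<q}" f] by (simp add: card_insert_if)
  have card_L: "card (L i) \<le> q + 1" for i
    unfolding L_def by (auto split: sum.split intro: card_insert_image)
  have affine: "Inl (x, y) \<in> L (Inl (m, b)) \<longleftrightarrow> x < q \<and> y = T m x b"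
    and slope: "Inr (Inl m') \<in> L (Inl (m, b)) \<longleftrightarrow> m' = m"
    and vertical: "Inl (x, y) \<in> L (Inr (Inl c)) \<longleftrightarrow> x = c \<and> y < q"
    and top: "Inr (Inr u) \<in> L (Inr k)"
    and infinity: "Inr (Inl m) \<in> L (Inr (Inr u)) \<longleftrightarrow> m < q"
    for x y m m' b c u k
    by (auto simp: L_def split: sum.split)
  have Inl_S: "Inl (m, b) \<in> S \<longleftrightarrow> m < q \<and> b < q" and Inr_S: "Inr (Inl c) \<in> S \<longleftrightarrow> c < q"
    and Top_S: "Inr (Inr u) \<in> S" for m b c u
    by (auto simp: S_def)
  have pair: "\<exists>i\<in>S. P \<in> L i \<and> P' \<in> L i" if P: "P \<in> S" "P' \<in> S" for P P'
  proof -
    have aff: "\<exists>i\<in>S. Inl (x, y) \<in> L i \<and> R \<in> L i" if xy: "x < q" "y < q" and R: "R \<in> S" for x y R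
    proof (cases R)
      case (Inl a)
      then obtain x' y' where R': "R = Inl (x', y')" "x' < q" "y' < q" using R by (cases a) (auto simp: Inl_S)
      show ?thesis
      proof (cases "x = x'")
        case True
        then show ?thesis using R' xy by (intro bexI[of _ "Inr (Inl x)"]) (auto simp: vertical Inr_S)
      next
        case False
        then obtain m b where "m < q" "b < q" "T m x b = y" "T m x' b = y'"
          using T2[OF xy(1) R'(2) xy(2) R'(3) False] by blast
        then show ?thesis using R' xy by (intro bexI[of _ "Inl (m, b)"]) (auto simp: affine Inl_S)
      qed
    next
      case (Inr a)
      show ?thesis
      proof (cases a)
        case (Inl m)
        then have m: "m < q" "R = Inr (Inl m)" using \<open>R = Inr a\<close> R by (auto simp: Inr_S)
        then obtain b where "b < q" "T m x b = y" using T1[OF m(1) xy] by blast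
        then show ?thesis using m xy by (intro bexI[of _ "Inl (m, b)"]) (auto simp: affine slope Inl_S)
      next
        case (Inr u)
        then show ?thesis using \<open>R = Inr a\<close> xy
          by (intro bexI[of _ "Inr (Inl x)"]) (auto simp: vertical top Inr_S)
      qed
    qed
    consider x y where "P = Inl (x, y)" "x < q" "y < q" | x y where "P' = Inl (x, y)" "x < q" "y < q"
      | a a' where "P = Inr a" "P' = Inr a'"
      using P by (auto simp: S_def)
    then show ?thesis
    proof cases
      case 1
      then show ?thesis using aff P by blast
    next
      case 2
      then show ?thesis using aff[of _ _ P] P by blast
    next
      case 3
      have "Inr a \<in> L (Inr (Inr ()))" if "Inr a \<in> S" for a
        using that by (cases a) (auto simp: infinity top Inr_S)
      then show ?thesis using 3 P Top_S by blast
    qed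
  qed
  obtain h where h: "bij_betw h {1..q\<^sup>2 + q + 1} S"
    using ex_bij_betw_nat_finite_1[OF fin] by (auto simp: card_S)
  obtain f where f: "bij_betw f {..<q\<^sup>2 + q + 1} S"
    using ex_bij_betw_nat_finite[OF fin] by (auto simp: card_S lessThan_atLeast0)
  define l where "l i = {x. x < q\<^sup>2 + q + 1 \<and> f x \<in> L (h i)}" for i
  show ?thesis
  proof (rule that[of l])
    fix i
    show "l i \<subseteq> {..<q\<^sup>2 + q + 1}" by (auto simp: l_def)
    have "card (l i) \<le> card (L (h i))"
    proof (rule card_inj_on_le[of f])
      show "inj_on f (l i)"
        using f by (auto simp: bij_betw_def l_def intro: inj_on_subset)
      show "finite (L (h i))" by (auto simp: L_def split: sum.split)
    qed (auto simp: l_def)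
    then show "card (l i) \<le> q + 1" using card_L[of "h i"] by linarith
  next
    fix x y assume xy: "x < q\<^sup>2 + q + 1" "y < q\<^sup>2 + q + 1"
    then have "f x \<in> S" "f y \<in> S" using f by (auto simp: bij_betw_def)
    then obtain k where k: "k \<in> S" "f x \<in> L k" "f y \<in> L k" using pair by blast
    then obtain i where "i \<in> {1..q\<^sup>2 + q + 1}" "k = h i" using h by (auto simp: bij_betw_def)
    then show "\<exists>i\<in>{1..q\<^sup>2 + q + 1}. x \<in> l i \<and> y \<in> l i"
      using k xy by (auto simp: l_def)
  qed
qed

section \<open>Counting edges: the upper bound\<close>

text \<open>
  Among all ways to divide at most \<open>n\<close> vertices into a given number of blocks of size at least 2,
  the sum of squares is essentially largest when one block takes everything that the others can
  spare. Quantitatively, let \<open>d S = card S - 2 \<ge> 0\<close> be the excess of a block. Then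
  \<open>(card S)\<^sup>2 = 4 card S - 4 + (d S)\<^sup>2\<close>, and the squares of the excesses add up to at most the
  square of the total excess.
\<close>

lemma sum_squares_of_large_blocks:
  fixes P :: "'a set set"
  assumes fin: "finite P" "\<And>S. S \<in> P \<Longrightarrow> finite S" and large: "\<And>S. S \<in> P \<Longrightarrow> 2 \<le> card S"
    and total: "(\<Sum>S\<in>P. card S) \<le> n"
  shows "2 * card P \<le> n" and "(\<Sum>S\<in>P. (card S)\<^sup>2) \<le> 4 * n + (n - 2 * card P)\<^sup>2"
proof -
  define d where "d S = card S - 2" for S :: "'a set"
  have card: "card S = d S + 2" if "S \<in> P" for S using large[OF that] by (simp add: d_def)
  have "(\<Sum>S\<in>P. card S) = (\<Sum>S\<in>P. d S + 2)" by (rule sum.cong[OF refl card])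
  also have "\<dots> = sum d P + 2 * card P" by (simp only: sum.distrib) simp
  finally have "(\<Sum>S\<in>P. card S) = sum d P + 2 * card P" .
  then have D: "sum d P + 2 * card P \<le> n" using total by simp
  then show "2 * card P \<le> n" by simp
  have sq: "(\<Sum>S\<in>P. (d S)\<^sup>2) \<le> (sum d P)\<^sup>2"
    using fin(1)
  proof induction
    case (insert S P)
    then show ?case by (simp add: power2_sum)
  qed simp
  have "(\<Sum>S\<in>P. (card S)\<^sup>2) = (\<Sum>S\<in>P. 4 * card S + (d S)\<^sup>2 - 4)"
    using card by (intro sum.cong) (auto simp: power2_eq_square algebra_simps)
  also have "\<dots> \<le> (\<Sum>S\<in>P. 4 * card S + (d S)\<^sup>2)" by (intro sum_mono) simp
  also have "\<dots> = 4 * (\<Sum>S\<in>P. card S) + (\<Sum>S\<in>P. (d S)\<^sup>2)"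
    by (simp add: sum.distrib sum_distrib_left)
  also have "\<dots> \<le> 4 * n + (sum d P)\<^sup>2" using total sq by (intro add_mono mult_left_mono) auto
  also have "\<dots> \<le> 4 * n + (n - 2 * card P)\<^sup>2" using D by (intro add_left_mono power_mono) auto
  finally show "(\<Sum>S\<in>P. (card S)\<^sup>2) \<le> 4 * n + (n - 2 * card P)\<^sup>2" .
qed

text \<open>
  Every component of a colour class has at least two vertices, because each vertex is an endpoint of
  an edge of the class. All arcs run inside components, so the preceding bound applies. Each edge is
  counted as two arcs.
\<close>

lemma card_arcs_le_of_num_components:
  fixes c n i
  defines "H \<equiv> colour_class (complete_graph n) c i"
  shows "2 * num_components H \<le> n"
    and "card (parcs H) \<le> 4 * n + (n - 2 * num_components H)\<^sup>2"
proof -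
  interpret pair_graph H unfolding H_def by (rule pair_graph_colour_class)
  have num: "num_components H = card sccs_verts" by (simp add: num_components_def card_sccs_verts)
  have sub: "S \<subseteq> pverts H" if "S \<in> sccs_verts" for S using sccs_verts_subsets[OF that] by simp
  have fin: "finite S" if "S \<in> sccs_verts" for S
    using sub[OF that] finite_subset finite_verts by fastforce
  have arc: "v \<in> scc_of u" if "(u, v) \<in> parcs H" for u v
  proof -
    have "(v, u) \<in> parcs H" using that arcs_symmetric by blast
    then have "u \<rightarrow>\<^sup>*\<^bsub>with_proj H\<^esub> v" "v \<rightarrow>\<^sup>*\<^bsub>with_proj H\<^esub> u" using that by (auto intro: reachable_adjI)
    then show ?thesis by (simp add: scc_of_def)
  qed
  have large: "2 \<le> card S" if S: "S \<in> sccs_verts" for S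
  proof -
    obtain u where u: "u \<in> pverts H" "S = scc_of u" using S by (auto simp: sccs_verts_conv_scc_of)
    then obtain a b where "(a, b) \<in> parcs (complete_graph n)" "c {a, b} = i" "u \<in> {a, b}"
      by (auto simp: H_def colour_class_def edge_set_def)
    then have "(a, b) \<in> parcs H" "(b, a) \<in> parcs H" "a \<noteq> b" "u = a \<or> u = b"
      by (auto simp: H_def colour_class_def complete_graph_def insert_commute)
    then obtain v where "(u, v) \<in> parcs H" "u \<noteq> v" by blast
    moreover have "u \<in> S" using u in_scc_of_self by simp
    ultimately have "{u, v} \<subseteq> S" "card {u, v} = 2" using arc u by auto
    then show ?thesis using card_mono[OF fin[OF S]] by metis
  qed
  have "(\<Sum>S\<in>sccs_verts. card S) = card (\<Union>sccs_verts)"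
    using fin sccs_verts_disjoint by (intro card_Union_disjoint[symmetric]) (auto simp: pairwise_def disjnt_def)
  also have "\<dots> \<le> card {1..n}"
    using sub pverts_colour_class_subset[of n c i] unfolding H_def[symmetric] by (intro card_mono) blast+
  finally have total: "(\<Sum>S\<in>sccs_verts. card S) \<le> n" by simp
  note blocks = sum_squares_of_large_blocks[OF finite_sccs_verts fin large total]
  show "2 * num_components H \<le> n" using blocks(1) by (simp add: num)
  have "parcs H \<subseteq> (\<Union>S\<in>sccs_verts. S \<times> S)"
  proof
    fix e assume e: "e \<in> parcs H"
    obtain u v where uv: "e = (u, v)" by (cases e)
    then have "u \<in> pverts H" using e in_arcsD1 by simp
    then have "scc_of u \<in> sccs_verts" "u \<in> scc_of u"
      using scc_of_in_sccs_verts in_scc_of_self by auto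
    then show "e \<in> (\<Union>S\<in>sccs_verts. S \<times> S)" using arc e uv by blast
  qed
  then have "card (parcs H) \<le> card (\<Union>S\<in>sccs_verts. S \<times> S)"
    using fin finite_sccs_verts by (intro card_mono) auto
  also have "\<dots> \<le> (\<Sum>S\<in>sccs_verts. card (S \<times> S))"
    by (rule card_UN_le[OF finite_sccs_verts])
  also have "\<dots> = (\<Sum>S\<in>sccs_verts. (card S)\<^sup>2)" by (simp add: card_cartesian_product power2_eq_square)
  also have "\<dots> \<le> 4 * n + (n - 2 * num_components H)\<^sup>2" using blocks(2) by (simp add: num)
  finally show "card (parcs H) \<le> 4 * n + (n - 2 * num_components H)\<^sup>2" .
qed

lemma max_min_components_attained:
  assumes "k \<ge> 1"
  obtains c where "c \<in> edge_colourings (complete_graph n) k"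
    and "max_min_components n k = min_components (complete_graph n) k c"
proof -
  have "max_min_components n k \<in> min_components (complete_graph n) k ` edge_colourings (complete_graph n) k"
    unfolding max_min_components_def
    using assms by (intro Max_in) (auto simp: finite_edge_colourings edge_colourings_nonempty)
  then show ?thesis using that by blast
qed

lemma card_parcs_complete_graph: "card (parcs (complete_graph n)) = n * (n - 1)"
proof -
  have "parcs (complete_graph n) = (SIGMA u:{1..n}. {1..n} - {u})"
    by (auto simp: complete_graph_def)
  then show ?thesis by simp
qed

text \<open>
  In an optimal colouring every colour has at least \<open>f = max_min_components n k\<close> components, hence
  at most \<open>4 n + (n - 2 f)\<^sup>2\<close> arcs, while the \<open>k\<close> colours together have to account for all arcs of
  the complete graph.
\<close>

lemma max_min_components_edge_count:
  assumes k: "k \<ge> 1"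
  shows "2 * max_min_components n k \<le> n"
    and "n * (n - 1) \<le> k * (4 * n + (n - 2 * max_min_components n k)\<^sup>2)"
proof -
  let ?K = "complete_graph n"
  define f where "f = max_min_components n k"
  obtain c where c: "c \<in> edge_colourings ?K k" and f: "f = min_components ?K k c"
    unfolding f_def using max_min_components_attained[OF k] by blast
  define H where "H i = colour_class ?K c i" for i
  have le: "f \<le> num_components (H i)" if "i \<in> {1..k}" for i
    unfolding f min_components_def H_def using that by (intro Min_le) auto
  have "2 * num_components (H 1) \<le> n" unfolding H_def by (rule card_arcs_le_of_num_components)
  moreover have "f \<le> num_components (H 1)" using le[of 1] k by simp
  ultimately show "2 * max_min_components n k \<le> n" unfolding f_def by linarith
  have "parcs ?K \<subseteq> (\<Union>i\<in>{1..k}. parcs (H i))"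
  proof
    fix e assume e: "e \<in> parcs ?K"
    obtain u v where uv: "e = (u, v)" by (cases e)
    then have "{u, v} \<in> edge_set ?K" using e by (auto simp: edge_set_def)
    then have "c {u, v} \<in> {1..k}" using c by (auto simp: edge_colourings_def dest: PiE_mem)
    then show "e \<in> (\<Union>i\<in>{1..k}. parcs (H i))" using e uv by (auto simp: H_def colour_class_def)
  qed
  moreover have "finite (parcs (H i))" for i
  proof -
    interpret pair_graph "H i" unfolding H_def by (rule pair_graph_colour_class)
    show ?thesis using finite_arcs by simp
  qed
  ultimately have "card (parcs ?K) \<le> card (\<Union>i\<in>{1..k}. parcs (H i))" by (intro card_mono) auto
  also have "\<dots> \<le> (\<Sum>i\<in>{1..k}. card (parcs (H i)))" by (rule card_UN_le) simp
  also have "\<dots> \<le> (\<Sum>i\<in>{1..k}. 4 * n + (n - 2 * f)\<^sup>2)"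
  proof (rule sum_mono)
    fix i assume i: "i \<in> {1..k}"
    have "card (parcs (H i)) \<le> 4 * n + (n - 2 * num_components (H i))\<^sup>2"
      unfolding H_def by (rule card_arcs_le_of_num_components)
    also have "\<dots> \<le> 4 * n + (n - 2 * f)\<^sup>2" using le[OF i] by (intro add_left_mono power_mono) auto
    finally show "card (parcs (H i)) \<le> 4 * n + (n - 2 * f)\<^sup>2" .
  qed
  also have "\<dots> = k * (4 * n + (n - 2 * f)\<^sup>2)" by simp
  finally show "n * (n - 1) \<le> k * (4 * n + (n - 2 * max_min_components n k)\<^sup>2)"
    by (simp add: card_parcs_complete_graph f_def)
qed

text \<open>
  Solve the edge count for \<open>f\<close>: it gives \<open>(n - 2 f)\<^sup>2 \<ge> n\<^sup>2 (1/k - 5/n)\<close>. The factor \<open>1 + \<dots>\<close> is the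
  quotient of the resulting bound \<open>n (1 - sqrt (1/k - 5/n)) / 2\<close> by the main term. For small \<open>n\<close> the
  radicand is negative, and so is its square root in the convention for reals, which makes the bound
  trivially true.
\<close>

lemma max_min_components_upper:
  assumes k: "k \<ge> 3" and n: "n \<ge> 1"
  shows "real (max_min_components n k)
    \<le> real n * (1 / 2 - 1 / (2 * sqrt (real k))) *
       (1 + ((1 - sqrt (1 / real k - 5 / real n)) / (1 - 1 / sqrt (real k)) - 1))"
proof -
  define f where "f = max_min_components n k"
  define w where "w = sqrt (1 / real k - 5 / real n)"
  have f: "2 * f \<le> n" "n * (n - 1) \<le> k * (4 * n + (n - 2 * f)\<^sup>2)"
    using max_min_components_edge_count[of k n] k unfolding f_def by auto
  have "real (n * (n - 1)) \<le> real (k * (4 * n + (n - 2 * f)\<^sup>2))" using f(2) of_nat_mono by blast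
  then have "real n * (real n - 1) \<le> real k * (4 * real n + (real n - 2 * real f)\<^sup>2)"
    using f(1) n by (simp add: of_nat_diff)
  then have "real n * (real n - 1) / real k \<le> 4 * real n + (real n - 2 * real f)\<^sup>2"
    using k by (simp add: field_simps)
  moreover have "(real n)\<^sup>2 * (1 / real k - 5 / real n) \<le> real n * (real n - 1) / real k - 4 * real n"
    using k n by (simp add: field_simps power2_eq_square)
  ultimately have "(real n)\<^sup>2 * (1 / real k - 5 / real n) \<le> (real n - 2 * real f)\<^sup>2" by linarith
  then have "sqrt ((real n)\<^sup>2 * (1 / real k - 5 / real n)) \<le> real n - 2 * real f"
    using f(1) by (intro real_le_lsqrt) auto
  then have "real n * w \<le> real n - 2 * real f" by (simp add: real_sqrt_mult w_def)
  then have le: "real f \<le> (real n - real n * w) / 2" by simp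
  have eq: "real n * (1 / 2 - 1 / (2 * sqrt (real k))) * (1 + ((1 - w) / (1 - 1 / sqrt (real k)) - 1))
      = (real n - real n * w) / 2"
  proof -
    define d where "d = 1 - 1 / sqrt (real k)"
    have "d > 0" using k by (simp add: d_def)
    have "1 / 2 - 1 / (2 * sqrt (real k)) = d / 2" by (simp add: d_def diff_divide_distrib)
    then show ?thesis using \<open>d > 0\<close> unfolding d_def[symmetric] by (simp only:) (simp add: field_simps)
  qed
  show ?thesis unfolding f_def[symmetric] w_def[symmetric] eq by (rule le)
qed

section \<open>Colouring by lines and matchings: the lower bound\<close>

lemma independent_vertices_le_num_components:
  assumes H: "pair_graph H" and A: "A \<subseteq> pverts H"
    and sep: "\<And>u v. u \<in> A \<Longrightarrow> v \<in> A \<Longrightarrow> u \<rightarrow>\<^sup>*\<^bsub>with_proj H\<^esub> v \<Longrightarrow> u = v"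
  shows "card A \<le> num_components H"
proof -
  interpret pair_graph H by (rule H)
  have "inj_on scc_of A"
  proof (rule inj_onI)
    fix u v assume "u \<in> A" "v \<in> A" "scc_of u = scc_of v"
    moreover have "v \<in> scc_of v" using \<open>v \<in> A\<close> A by (intro in_scc_of_self) auto
    ultimately show "u = v" using sep by (auto simp: scc_of_def)
  qed
  then have "card A \<le> card sccs_verts"
  proof (rule card_inj_on_le)
    show "scc_of ` A \<subseteq> sccs_verts" using A by (auto intro!: scc_of_in_sccs_verts)
  qed (rule finite_sccs_verts)
  then show ?thesis by (simp add: num_components_def card_sccs_verts)
qed

text \<open>
  A vertex \<open>v\<close> belongs to the group \<open>v mod Q\<close>, which stands for a point of the plane, and has
  position \<open>v div Q\<close> inside its group. The matching of colour \<open>i\<close> lives in the groups off the line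
  \<open>l i\<close> and joins two vertices of the same group whose positions add up to \<open>s - i\<close>. Prescribing the
  sum of the positions makes it a matching, and distinct colours prescribe distinct sums, so the
  matchings of distinct colours share no edge.
\<close>

definition matched :: "nat \<Rightarrow> nat \<Rightarrow> (nat \<Rightarrow> nat set) \<Rightarrow> nat \<Rightarrow> nat set \<Rightarrow> bool" where
  "matched Q s l i e \<longleftrightarrow> (\<exists>u v. e = {u, v} \<and> u mod Q = v mod Q \<and> u mod Q \<notin> l i \<and>
     u div Q + v div Q + i = s)"

text \<open>
  Matched edges receive the colour of their matching. Every other edge receives the number of some
  line through the points of its two end groups.
\<close>

definition line_colouring :: "nat \<Rightarrow> nat \<Rightarrow> (nat \<Rightarrow> nat set) \<Rightarrow> nat \<Rightarrow> nat \<Rightarrow> nat set \<Rightarrow> nat" where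
  "line_colouring Q s l k n = restrict (\<lambda>e.
     if \<exists>i\<in>{1..k}. matched Q s l i e then SOME i. i \<in> {1..k} \<and> matched Q s l i e
     else SOME i. i \<in> {1..k} \<and> (\<lambda>v. v mod Q) ` e \<subseteq> l i) (edge_set (complete_graph n))"

lemma matched_pair_iff:
  "matched Q s l i {u, v} \<longleftrightarrow>
     u mod Q = v mod Q \<and> u mod Q \<notin> l i \<and> u div Q + v div Q + i = s"
  unfolding matched_def by (auto simp: doubleton_eq_iff add_ac)

text \<open>
  Let \<open>u\<close> be a vertex whose group is off the line \<open>l i\<close>. An edge of colour \<open>i\<close> at \<open>u\<close> cannot have
  been coloured by its line, so it is a matched edge. Hence each edge of the \<open>i\<close>-th matching is a
  whole component of colour \<open>i\<close>, and the number of components is at least the size of this matching.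
  The edges are counted by their endpoint with the smaller position \<open>a\<close>, where \<open>1 \<le> a\<close> and
  \<open>2 a < s - i\<close>. All positions between 1 and \<open>s - 1\<close> do occur among the vertices \<open>1, \<dots>, n\<close> in every
  group; position 0 is left out because 0 is not a vertex.
\<close>

lemma components_of_line_colouring:
  fixes Q k n r :: nat and l :: "nat \<Rightarrow> nat set"
  defines "s \<equiv> n div Q"
  defines "c \<equiv> line_colouring Q s l k n"
  assumes Q: "Q > 0"
    and cover: "\<And>x y. x < Q \<Longrightarrow> y < Q \<Longrightarrow> \<exists>i\<in>{1..k}. x \<in> l i \<and> y \<in> l i"
  shows "c \<in> edge_colourings (complete_graph n) k"
    and "i \<in> {1..k} \<Longrightarrow> l i \<subseteq> {..<Q} \<Longrightarrow> card (l i) \<le> r \<Longrightarrow>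
      (Q - r) * ((s - i - 1) div 2) \<le> num_components (colour_class (complete_graph n) c i)"
proof -
  let ?K = "complete_graph n"
  have "c e \<in> {1..k} \<and> (if \<exists>i\<in>{1..k}. matched Q s l i e then matched Q s l (c e) e
      else (\<lambda>v. v mod Q) ` e \<subseteq> l (c e))" if e: "e \<in> edge_set ?K" for e
  proof (cases "\<exists>i\<in>{1..k}. matched Q s l i e")
    case True
    then have "\<exists>i. i \<in> {1..k} \<and> matched Q s l i e" by blast
    from someI_ex[OF this] show ?thesis using True e by (simp add: c_def line_colouring_def)
  next
    case False
    obtain u v where "e = {u, v}" using e by (auto simp: edge_set_def)
    then have "\<exists>i. i \<in> {1..k} \<and> (\<lambda>v. v mod Q) ` e \<subseteq> l i"
      using cover[of "u mod Q" "v mod Q"] Q by auto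
    from someI_ex[OF this] show ?thesis using False e by (simp add: c_def line_colouring_def)
  qed
  note c = this
  have "c \<in> extensional (edge_set ?K)" by (simp add: c_def line_colouring_def)
  with c show "c \<in> edge_colourings ?K k" by (auto simp: edge_colourings_def PiE_def)

  assume i: "i \<in> {1..k}" and sub_l: "l i \<subseteq> {..<Q}" and card_l: "card (l i) \<le> r"
  define H where "H = colour_class ?K c i"
  have arc: "(u, v) \<in> parcs H \<longleftrightarrow> u \<in> {1..n} \<and> v \<in> {1..n} \<and> u \<noteq> v \<and> c {u, v} = i" for u v
    by (auto simp: H_def colour_class_def complete_graph_def)
  have in_edge_set: "{u, v} \<in> edge_set ?K" if "u \<in> {1..n}" "v \<in> {1..n}" "u \<noteq> v" for u v
    using that by (auto simp: edge_set_def complete_graph_def)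
  have arc_matched: "u div Q + v div Q + i = s \<and> u mod Q = v mod Q"
    if "(u, v) \<in> parcs H" "u mod Q \<notin> l i" for u v
    using c[OF in_edge_set[of u v]] that by (auto simp: arc matched_pair_iff split: if_splits)
  have matched_arc: "(u, v) \<in> parcs H"
    if uv: "u \<in> {1..n}" "v \<in> {1..n}" "u \<noteq> v" and m: "matched Q s l i {u, v}" for u v
  proof -
    have "matched Q s l (c {u, v}) {u, v}"
      using c[OF in_edge_set[OF uv]] m i by (auto split: if_splits)
    then have "c {u, v} = i" using m by (simp add: matched_pair_iff)
    then show ?thesis using uv by (simp add: arc)
  qed
  \<comment> \<open>\<open>A\<close> has the vertex with the smaller position from each matched edge with positive positions.\<close>
  define A where "A = (\<lambda>(g, a). a * Q + g) ` (({..<Q} - l i) \<times> {1..(s - i - 1) div 2})"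
  have A: "a \<in> A \<longleftrightarrow> a mod Q \<notin> l i \<and> 1 \<le> a div Q \<and> a div Q \<le> (s - i - 1) div 2" for a
  proof
    show "a \<in> A \<Longrightarrow> a mod Q \<notin> l i \<and> 1 \<le> a div Q \<and> a div Q \<le> (s - i - 1) div 2"
      by (auto simp: A_def)
    assume "a mod Q \<notin> l i \<and> 1 \<le> a div Q \<and> a div Q \<le> (s - i - 1) div 2"
    then show "a \<in> A" using Q unfolding A_def
      by (intro image_eqI[of _ _ "(a mod Q, a div Q)"]) auto
  qed
  have "inj_on (\<lambda>(g, a). a * Q + g) (({..<Q} - l i) \<times> {1..(s - i - 1) div 2})"
  proof (rule inj_onI, clarsimp)
    fix g a g' a' assume "g < Q" "g' < Q" and eq: "a * Q + g = a' * Q + g'"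
    have "(a * Q + g) mod Q = (a' * Q + g') mod Q" "(a * Q + g) div Q = (a' * Q + g') div Q"
      by (simp_all only: eq)
    then show "g = g' \<and> a = a'" using \<open>g < Q\<close> \<open>g' < Q\<close> by simp
  qed
  then have "card A = card ({..<Q} - l i) * ((s - i - 1) div 2)"
    unfolding A_def by (subst card_image) (auto simp: card_cartesian_product)
  moreover have "Q - r \<le> card ({..<Q} - l i)"
    using card_l sub_l finite_subset[OF sub_l] by (simp add: card_Diff_subset)
  ultimately have "(Q - r) * ((s - i - 1) div 2) \<le> card A" by (simp add: mult_right_mono)
  also have "\<dots> \<le> num_components H"
  proof (rule independent_vertices_le_num_components)
    show "pair_graph H" unfolding H_def by (rule pair_graph_colour_class)
    interpret pair_graph H unfolding H_def by (rule pair_graph_colour_class)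
    \<comment> \<open>The other end of the edge that colour \<open>i\<close> matches with \<open>u\<close>.\<close>
    define partner where "partner u = (s - i - u div Q) * Q + u mod Q" for u
    have partner: "u \<in> {1..n} \<and> partner u \<in> {1..n} \<and> u \<noteq> partner u \<and> matched Q s l i {u, partner u}
      \<and> partner u \<notin> A" if u: "u \<in> A" for u
    proof -
      have ua: "u mod Q \<notin> l i" "1 \<le> u div Q" "2 * (u div Q) < s - i" using u by (auto simp: A)
      have d: "partner u div Q = s - i - u div Q" "partner u mod Q = u mod Q"
        using Q by (simp_all add: partner_def)
      have small: "w \<in> {1..n}" if "1 \<le> w div Q" "w div Q < s" for w
      proof -
        have "w < n"
        proof (rule ccontr)
          assume "\<not> w < n"
          then have "n div Q \<le> w div Q" by (intro div_le_mono) simp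
          then show False using that by (simp add: s_def)
        qed
        moreover have "w \<noteq> 0" using that by (intro notI) simp
        ultimately show ?thesis by simp
      qed
      have "u \<in> {1..n}" by (rule small) (use ua in auto)
      moreover have "partner u \<in> {1..n}" by (rule small) (use ua d in auto)
      moreover have "u \<noteq> partner u" "partner u \<notin> A" using ua d by (auto simp: A)
      moreover have "matched Q s l i {u, partner u}" using ua d by (simp add: matched_pair_iff)
      ultimately show ?thesis by blast
    qed
    have arcs: "(u, partner u) \<in> parcs H" if "u \<in> A" for u
      using partner[OF that] matched_arc by blast
    then show "A \<subseteq> pverts H" using in_arcsD1 by fastforce
    fix u v assume u: "u \<in> A" and v: "v \<in> A" and "u \<rightarrow>\<^sup>*\<^bsub>with_proj H\<^esub> v"
    have um: "u mod Q \<notin> l i" "u div Q \<le> s - i" using u by (auto simp: A)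
    have dp: "partner u div Q = s - i - u div Q" "partner u mod Q = u mod Q"
      using Q by (simp_all add: partner_def)
    from \<open>u \<rightarrow>\<^sup>*\<^bsub>with_proj H\<^esub> v\<close> have "v \<in> {u, partner u}"
    proof (induction rule: reachable_induct)
      case base
      then show ?case by simp
    next
      case (step x y)
      then have xy: "(x, y) \<in> parcs H" by auto
      have "x mod Q = u mod Q" using step.IH dp by auto
      then have y: "x div Q + y div Q + i = s" "y mod Q = u mod Q" using arc_matched[OF xy] um by auto
      have "y div Q = u div Q \<or> y div Q = partner u div Q" using step.IH y dp um by auto
      then show ?case using y(2) dp(2) by (metis insertCI div_mult_mod_eq)
    qed
    then show "u = v" using partner[OF u] v by auto
  qed
  finally show "(Q - r) * ((s - i - 1) div 2) \<le> num_components (colour_class ?K c i)" by (simp add: H_def)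
qed

text \<open>
  With \<open>Q = p\<^sup>2 + p + 1\<close> points, the \<open>Q - (p + 1) = p\<^sup>2\<close> groups off a line each contribute about
  \<open>n / (2 Q)\<close> matched edges, and \<open>1/2 - (p + 1)/(2 Q) = p\<^sup>2/(2 Q)\<close>. The constant \<open>k + 3\<close> collects
  what is lost by rounding and by the shift \<open>i \<le> k\<close> of the sum of positions. Colours beyond \<open>Q\<close> are
  covered by the same count: for them too, \<open>l i\<close> has at most \<open>p + 1\<close> points.
\<close>

lemma max_min_components_lower:
  assumes p: "prime_power_or_one p" and pk: "p\<^sup>2 + p + 1 \<le> k" and n: "n \<ge> 1"
  shows "real (max_min_components n k) \<ge>
    real n * (1 / 2 - (real p + 1) / (2 * (real p ^ 2 + real p + 1))) *
      (1 + - (real k + 3) * (real p ^ 2 + real p + 1) / real n)"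
proof -
  define Q where "Q = p\<^sup>2 + p + 1"
  have Q: "Q > 0" "Q \<le> k" using pk by (auto simp: Q_def)
  obtain l where l: "\<And>i. l i \<subseteq> {..<Q}" "\<And>i. card (l i) \<le> p + 1"
    and cover: "\<And>x y. x < Q \<Longrightarrow> y < Q \<Longrightarrow> \<exists>i\<in>{1..Q}. x \<in> l i \<and> y \<in> l i"
    using projective_plane_exists[OF p] unfolding Q_def by blast
  have cover': "\<exists>i\<in>{1..k}. x \<in> l i \<and> y \<in> l i" if "x < Q" "y < Q" for x y
    using cover[OF that] Q(2) by (meson atLeastAtMost_iff order_trans)
  let ?K = "complete_graph n"
  define c where "c = line_colouring Q (n div Q) l k n"
  have c: "c \<in> edge_colourings ?K k"
    unfolding c_def by (rule components_of_line_colouring(1)[OF Q(1) cover'])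
  have comps: "(Q - (p + 1)) * ((n div Q - i - 1) div 2) \<le> num_components (colour_class ?K c i)"
    if "i \<in> {1..k}" for i
    unfolding c_def by (rule components_of_line_colouring(2)[OF Q(1) cover' that l])
  have "min_components ?K k c \<in> (\<lambda>i. num_components (colour_class ?K c i)) ` {1..k}"
    unfolding min_components_def using Q by (intro Min_in) auto
  then obtain i where i: "i \<in> {1..k}" "min_components ?K k c = num_components (colour_class ?K c i)"
    by blast
  have "num_components (colour_class ?K c i) \<le> max_min_components n k"
    unfolding i(2)[symmetric] max_min_components_def using c by (intro Max_ge) (auto simp: finite_edge_colourings)
  then have "p\<^sup>2 * ((n div Q - i - 1) div 2) \<le> max_min_components n k"
    using comps[OF i(1)] by (simp add: Q_def)
  then have "real (p\<^sup>2 * ((n div Q - i - 1) div 2)) \<le> real (max_min_components n k)"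
    by (rule of_nat_mono)
  then have "(real p)\<^sup>2 * ((real n / real Q - real k - 3) / 2) \<le> real (max_min_components n k)"
  proof (rule order_trans[rotated])
    show "(real p)\<^sup>2 * ((real n / real Q - real k - 3) / 2) \<le> real (p\<^sup>2 * ((n div Q - i - 1) div 2))"
    proof -
      have "real n / real Q - 1 \<le> real (n div Q)"
        by (metis floor_divide_of_nat_eq real_of_int_floor_gt_diff_one of_int_of_nat_eq less_imp_le)
      moreover have "real (n div Q) - real k - 2 \<le> 2 * real ((n div Q - i - 1) div 2)"
        using i(1) by auto
      moreover have "(a - b - 3) / 2 \<le> x" if "a - 1 \<le> t" "t - b - 2 \<le> 2 * x" for a b t x :: real
        using that by simp
      ultimately have "(real n / real Q - real k - 3) / 2 \<le> real ((n div Q - i - 1) div 2)" by blast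
      then have "(real p)\<^sup>2 * ((real n / real Q - real k - 3) / 2)
          \<le> (real p)\<^sup>2 * real ((n div Q - i - 1) div 2)"
        by (rule mult_left_mono) simp
      then show ?thesis by (simp only: of_nat_mult of_nat_power)
    qed
  qed
  moreover have "real n * (1 / 2 - (real p + 1) / (2 * real Q)) * (1 + - (real k + 3) * real Q / real n)
     = (real p)\<^sup>2 * ((real n / real Q - real k - 3) / 2)"
  proof -
    have "1 / 2 - (real p + 1) / (2 * real Q) = (real p)\<^sup>2 / (2 * real Q)"
      using Q(1) by (simp add: field_simps) (simp add: Q_def)
    moreover have "a * (x / (2 * y)) * (1 + - (b + 3) * y / a) = x * ((a / y - b - 3) / 2)"
      if "a > 0" "y > 0" for a b x y :: real
    proof -
      have "a * (x / (2 * y)) * (1 + - (b + 3) * y / a) = a * (1 + - (b + 3) * y / a) * (x / (2 * y))"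
        by (simp only: mult_ac)
      also have "a * (1 + - (b + 3) * y / a) = a - (b + 3) * y"
        using \<open>a > 0\<close> by (simp add: field_simps)
      also have "(a - (b + 3) * y) * (x / (2 * y)) = x * ((a / y - b - 3) / 2)"
        using \<open>y > 0\<close> by (simp add: field_simps)
      finally show ?thesis .
    qed
    ultimately show ?thesis using Q(1) n by simp
  qed
  ultimately have "real n * (1 / 2 - (real p + 1) / (2 * real Q)) * (1 + - (real k + 3) * real Q / real n)
      \<le> real (max_min_components n k)"
    by (simp only:)
  moreover have "real p ^ 2 + real p + 1 = real Q" by (simp add: Q_def)
  ultimately show ?thesis by (simp only:)
qed

section \<open>The asymptotic bounds\<close>

theorem corollary1p5:
  fixes k p :: nat
  assumes "k \<ge> 3"
    and "prime_power_or_one p" and "p\<^sup>2 + p + 1 \<le> k"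
    and "\<And>q. prime_power_or_one q \<Longrightarrow> q\<^sup>2 + q + 1 \<le> k \<Longrightarrow> q \<le> p"
  shows "\<exists>\<epsilon> \<delta> :: nat \<Rightarrow> real. \<epsilon> \<longlonglongrightarrow> 0 \<and> \<delta> \<longlonglongrightarrow> 0 \<and>
    (\<forall>\<^sub>F n in sequentially.
       real n * (1 / 2 - 1 / (2 * sqrt (real k))) * (1 + \<epsilon> n) \<ge> real (max_min_components n k) \<and>
       real (max_min_components n k) \<ge>
         real n * (1 / 2 - (real p + 1) / (2 * (real p ^ 2 + real p + 1))) * (1 + \<delta> n))"
proof (intro exI conjI)
  let ?\<epsilon> = "\<lambda>n. (1 - sqrt (1 / real k - 5 / real n)) / (1 - 1 / sqrt (real k)) - 1"
  let ?\<delta> = "\<lambda>n. - (real k + 3) * (real p ^ 2 + real p + 1) / real n"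
  have neq: "1 - 1 / sqrt (real k) \<noteq> 0" using \<open>k \<ge> 3\<close> by simp
  have "?\<epsilon> \<longlonglongrightarrow> (1 - sqrt (1 / real k - 0)) / (1 - 1 / sqrt (real k)) - 1"
    by (intro tendsto_intros lim_const_over_n neq)
  also have "(1 - sqrt (1 / real k - 0)) / (1 - 1 / sqrt (real k)) - 1 = 0"
    using neq by (simp add: real_sqrt_divide)
  finally show "?\<epsilon> \<longlonglongrightarrow> 0" .
  show "?\<delta> \<longlonglongrightarrow> 0" by (rule lim_const_over_n)
  show "\<forall>\<^sub>F n in sequentially.
       real n * (1 / 2 - 1 / (2 * sqrt (real k))) * (1 + ?\<epsilon> n) \<ge> real (max_min_components n k) \<and>
       real (max_min_components n k) \<ge>
         real n * (1 / 2 - (real p + 1) / (2 * (real p ^ 2 + real p + 1))) * (1 + ?\<delta> n)"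
    using eventually_ge_at_top[of 1]
  proof eventually_elim
    case (elim n)
    then show ?case
      using max_min_components_upper[OF \<open>k \<ge> 3\<close>] max_min_components_lower[OF assms(2,3)] by blast
  qed
qed

end
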